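(* Let $X$ be a set and let $\mathcal{S}$ be an indecomposable semigroup of nonnegative (real-valued) functions on $X \times X$, where the multiplication of $f$ and $g$ in $\mathcal{S}$ is defined by $$ (f*g)(x, y) = \sum_{z \in X} f(x,z)\, g(z,y), $$ the finiteness of this sum of nonnegative numbers for all $f, g \in \mathcal{S}$ and all $x, y \in X$ being part of the hypothesis. If every function $f \in \mathcal{S}$ has a binary diagonal, then there exists a function $d : X \to (0, \infty)$ such that $$ \frac{f(x, y)\, d(y)}{d(x)} \in \{ 0, 1 \} $$ for all $f \in \mathcal{S}$ and all $x, y \in X$.
   Context: A set $\mathcal{S}$ of nonnegative functions on $X \times X$ is indecomposable if for every $x, y \in X$ there exists $f \in \mathcal{S}$ such that $f(x,y) > 0$. A nonnegative function $f$ on $X \times X$ has a binary diagonal if $f(x,x) \in \{0, 1\}$ for all $x \in X$. *)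

theory Defs
  imports "HOL-Analysis.Infinite_Sum" "HOL-Library.FuncSet"
begin

text \<open>Real functions on \<open>X \<times> X\<close> are extensional (\<open>undefined\<close> outside \<open>X \<times> X\<close>), so that
  equality of HOL functions is equality of functions on \<open>X \<times> X\<close>.\<close>

text \<open>\<^const>\<open>infsum\<close> is \<open>0\<close> on families that are not summable; finiteness of the sum is demanded
  separately in \<open>nonneg_semigroup\<close>. For nonnegative families it is the
  supremum of the finite partial sums, and \<open>X\<close> may have any cardinality.\<close>

definition fun_times :: "'a set \<Rightarrow> ('a \<times> 'a \<Rightarrow> real) \<Rightarrow> ('a \<times> 'a \<Rightarrow> real) \<Rightarrow> ('a \<times> 'a \<Rightarrow> real)" where
  "fun_times X f g = (\<lambda>(x, y) \<in> X \<times> X. \<Sum>\<^sub>\<infinity>z\<in>X. f (x, z) * g (z, y))"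

text \<open>Associativity is not listed: it holds for every set satisfying the three conditions, by
  exchanging the order of summation of nonnegative terms.\<close>

definition nonneg_semigroup :: "'a set \<Rightarrow> ('a \<times> 'a \<Rightarrow> real) set \<Rightarrow> bool" where
  "nonneg_semigroup X S \<longleftrightarrow>
     S \<subseteq> (X \<times> X \<rightarrow>\<^sub>E {0..}) \<and>
     (\<forall>f\<in>S. \<forall>g\<in>S. \<forall>x\<in>X. \<forall>y\<in>X. (\<lambda>z. f (x, z) * g (z, y)) summable_on X) \<and>
     (\<forall>f\<in>S. \<forall>g\<in>S. fun_times X f g \<in> S)"

definition indecomposable :: "'a set \<Rightarrow> ('a \<times> 'a \<Rightarrow> real) set \<Rightarrow> bool" where
  "indecomposable X S \<longleftrightarrow> (\<forall>x\<in>X. \<forall>y\<in>X. \<exists>f\<in>S. f (x, y) > 0)"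

definition binary_diagonal :: "'a set \<Rightarrow> ('a \<times> 'a \<Rightarrow> real) \<Rightarrow> bool" where
  "binary_diagonal X f \<longleftrightarrow> (\<forall>x\<in>X. f (x, x) \<in> {0, 1})"

end

theory Submission
  imports Defs
begin

text \<open>Two functions \<open>f, g \<in> S\<close> with \<open>f (x, y) > 0\<close> and \<open>g (y, x) > 0\<close> satisfy
  \<open>f (x, y) * g (y, x) = 1\<close>: otherwise \<open>f * g\<close>, whose entry at \<open>(x, x)\<close> is \<open>1\<close>, gets a further
  contribution from some \<open>z \<noteq> y\<close>, and then \<open>(g * f) * (g * f)\<close> has an entry greater than \<open>1\<close> at
  \<open>(y, y)\<close>, because \<open>g * f\<close> is \<open>1\<close> at \<open>(y, y)\<close> and positive at \<open>(y, z)\<close> and \<open>(z, y)\<close>. Hence all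
  members of \<open>S\<close> that are positive at \<open>(x, y)\<close> share one value \<open>c x y\<close> there, with
  \<open>c x y * c y x = 1\<close> and \<open>c x y * c y z \<le> c x z\<close>. These force \<open>c x y * c y z = c x z\<close>, so
  \<open>d x = c x a\<close> works for any base point \<open>a\<close>.\<close>

lemma nonneg_semigroup_nonneg:
  assumes "nonneg_semigroup X S" "f \<in> S" "x \<in> X" "y \<in> X"
  shows "f (x, y) \<ge> 0"
proof -
  have "f \<in> X \<times> X \<rightarrow>\<^sub>E {0..}"
    using assms unfolding nonneg_semigroup_def by blast
  then show ?thesis
    using PiE_mem[of f "X \<times> X" "\<lambda>_. {0..}" "(x, y)"] assms by simp
qed

text \<open>Finite partial sums of a nonnegative summable family lie below its total. Summability
  matters, since \<open>infsum\<close> would otherwise default to 0.\<close>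

lemma fun_times_ge_sum:
  assumes "nonneg_semigroup X S" "f \<in> S" "g \<in> S" "x \<in> X" "y \<in> X" "finite A" "A \<subseteq> X"
  shows "(\<Sum>z\<in>A. f (x, z) * g (z, y)) \<le> fun_times X f g (x, y)"
proof -
  have "f (x, z) * g (z, y) \<ge> 0" if "z \<in> X" for z
    using nonneg_semigroup_nonneg[OF assms(1)] assms(2-5) that by simp
  moreover have "(\<lambda>z. f (x, z) * g (z, y)) summable_on X"
    using assms unfolding nonneg_semigroup_def by blast
  ultimately show ?thesis
    using assms by (auto simp: fun_times_def intro!: finite_sum_le_infsum)
qed

lemma fun_times_ge:
  assumes "nonneg_semigroup X S" "f \<in> S" "g \<in> S" "x \<in> X" "y \<in> X" "z \<in> X"
  shows "f (x, z) * g (z, y) \<le> fun_times X f g (x, y)"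
  using fun_times_ge_sum[OF assms(1-5), of "{z}"] assms(6) by simp

lemma fun_times_pos:
  assumes "nonneg_semigroup X S" "f \<in> S" "g \<in> S" "x \<in> X" "y \<in> X" "z \<in> X"
    and "f (x, z) > 0" "g (z, y) > 0"
  shows "fun_times X f g (x, y) > 0"
  using fun_times_ge[OF assms(1-6)] mult_pos_pos[OF assms(7,8)] by linarith

lemma fun_times_closed:
  assumes "nonneg_semigroup X S" "f \<in> S" "g \<in> S"
  shows "fun_times X f g \<in> S"
  using assms unfolding nonneg_semigroup_def by blast

lemma binary_diagonal_eq_1:
  assumes "binary_diagonal X f" "x \<in> X" "f (x, x) > 0"
  shows "f (x, x) = 1"
  using assms unfolding binary_diagonal_def by fastforce

lemma opposite_entries_mult_eq_1:
  assumes S: "nonneg_semigroup X S"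
    and bin: "\<And>f. f \<in> S \<Longrightarrow> binary_diagonal X f"
    and fg: "f \<in> S" "g \<in> S" and xy: "x \<in> X" "y \<in> X"
    and pos: "f (x, y) > 0" "g (y, x) > 0"
  shows "f (x, y) * g (y, x) = 1"
proof -
  \<comment> \<open>Once these terms vanish, the diagonal entry of the product at \<open>x\<close>
    is the single term at \<open>y\<close>.\<close>
  have "f (x, z) * g (z, x) = 0" if z: "z \<in> X" "z \<noteq> y" for z
  proof (rule ccontr)
    assume "f (x, z) * g (z, x) \<noteq> 0"
    then have pos_z: "f (x, z) > 0" "g (z, x) > 0"
      using nonneg_semigroup_nonneg[OF S] fg xy z by (auto simp: less_le)
    define h where "h = fun_times X g f"
    have h: "h \<in> S" "fun_times X h h \<in> S"
      unfolding h_def by (auto intro!: fun_times_closed[OF S] fg)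
    have "h (y, y) > 0" and pos_h: "h (y, z) > 0" "h (z, y) > 0"
      unfolding h_def
      using fun_times_pos[OF S fg(2,1) xy(2,2,1) pos(2,1)]
        fun_times_pos[OF S fg(2,1) xy(2) z(1) xy(1) pos(2) pos_z(1)]
        fun_times_pos[OF S fg(2,1) z(1) xy(2,1) pos_z(2) pos(1)] by simp_all
    then have h1: "h (y, y) = 1"
      using binary_diagonal_eq_1[OF bin[OF h(1)] xy(2)] by simp
    \<comment> \<open>As \<open>z\<close> differs from \<open>y\<close>, these are two separate
      terms of the sum, and the first alone is already 1.\<close>
    have "h (y, y) * h (y, y) + h (y, z) * h (z, y) \<le> fun_times X h h (y, y)"
      using fun_times_ge_sum[OF S h(1) h(1), of y y "{y, z}"] xy z by auto
    then have "fun_times X h h (y, y) > 1"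
      using h1 mult_pos_pos[OF pos_h] by simp
    then show False
      using binary_diagonal_eq_1[OF bin[OF h(2)] xy(2)] by simp
  qed
  then have "(\<Sum>\<^sub>\<infinity>z\<in>X. f (x, z) * g (z, x)) = (\<Sum>\<^sub>\<infinity>z\<in>{y}. f (x, z) * g (z, x))"
    using xy by (intro infsum_cong_neutral) auto
  then have "fun_times X f g (x, x) = f (x, y) * g (y, x)"
    using xy by (simp add: fun_times_def)
  moreover have "fun_times X f g (x, x) = 1"
    using binary_diagonal_eq_1[OF bin[OF fun_times_closed[OF S fg]] xy(1)]
      fun_times_pos[OF S fg xy(1,1,2) pos] by simp
  ultimately show ?thesis by simp
qed

theorem theorem3p2:
  fixes X :: "'a set" and S :: "('a \<times> 'a \<Rightarrow> real) set"
  assumes "nonneg_semigroup X S"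
    and "indecomposable X S"
    and "\<And>f. f \<in> S \<Longrightarrow> binary_diagonal X f"
  shows "\<exists>d \<in> X \<rightarrow> {0<..}. \<forall>f\<in>S. \<forall>x\<in>X. \<forall>y\<in>X. f (x, y) * d y / d x \<in> {0, 1 :: real}"
proof (cases "X = {}")
  case False
  then obtain a where a: "a \<in> X" by blast
  have "\<forall>x\<in>X. \<forall>y\<in>X. \<exists>f. f \<in> S \<and> f (x, y) > 0"
    using assms(2) unfolding indecomposable_def by blast
  then obtain F where F: "\<And>x y. x \<in> X \<Longrightarrow> y \<in> X \<Longrightarrow> F x y \<in> S \<and> F x y (x, y) > 0"
    by metis
  \<comment> \<open>The value does not depend on the choice of \<open>F\<close>, by
    \<open>eq_c\<close> below.\<close>
  define c where "c x y = F x y (x, y)" for x y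
  have c_pos: "c x y > 0" if "x \<in> X" "y \<in> X" for x y
    using F that by (simp add: c_def)
  have c_inv: "c x y * c y x = 1" if "x \<in> X" "y \<in> X" for x y
    unfolding c_def using opposite_entries_mult_eq_1[OF assms(1,3)] F that by blast
  have eq_c: "f (x, y) = c x y" if "f \<in> S" "x \<in> X" "y \<in> X" "f (x, y) > 0" for f x y
  proof -
    have "f (x, y) * c y x = 1"
      unfolding c_def using opposite_entries_mult_eq_1[OF assms(1,3)] F that by blast
    then show ?thesis
      using c_inv[OF that(2,3)] by (metis mult_cancel_right mult_zero_right zero_neq_one)
  qed
  have c_le: "c x y * c y z \<le> c x z" if "x \<in> X" "y \<in> X" "z \<in> X" for x y z
  proof -
    \<comment> \<open>The left-hand side is one term of \<open>?h (x, z)\<close>, and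
      \<open>eq_c\<close> fixes that entry as \<open>c x z\<close>.\<close>
    let ?h = "fun_times X (F x y) (F y z)"
    have "?h \<in> S" "?h (x, z) > 0"
      using fun_times_closed[OF assms(1)] fun_times_pos[OF assms(1), of "F x y" "F y z" x z y]
        F that by simp_all
    then have "?h (x, z) = c x z"
      using eq_c that by blast
    then show ?thesis
      using that fun_times_ge[OF assms(1), of "F x y" "F y z" x z y] F by (simp add: c_def)
  qed
  have c_mult: "c x y * c y z = c x z" if "x \<in> X" "y \<in> X" "z \<in> X" for x y z
  proof (rule antisym[OF c_le[OF that]])
    \<comment> \<open>Inserting \<open>c z y * c y z = 1\<close> turns the reverse inequality into
      \<open>c_le\<close> along the path from \<open>x\<close> through \<open>z\<close> to
      \<open>y\<close>.\<close>
    have "c x z = c x z * c z y * c y z"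
      using c_inv[of z y] that by simp
    also have "\<dots> \<le> c x y * c y z"
      using c_le[of x z y] c_pos[of y z] that by (intro mult_right_mono) auto
    finally show "c x z \<le> c x y * c y z" .
  qed
  show ?thesis
  proof (intro bexI[of _ "\<lambda>x. c x a"] ballI)
    fix f x y assume f: "f \<in> S" and xy: "x \<in> X" "y \<in> X"
    show "f (x, y) * c y a / c x a \<in> {0, 1}"
    proof (cases "f (x, y) = 0")
      case False
      then have "f (x, y) = c x y"
        using eq_c nonneg_semigroup_nonneg[OF assms(1)] f xy by (simp add: less_le)
      then show ?thesis
        using c_mult[OF xy a] c_pos[OF xy(1) a] by simp
    qed simp
  qed (use c_pos a in auto)
qed simp

end
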